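(* Let $G$ be a countable weakly branch group acting on a spherically homogeneous rooted tree $T$. Then the centralizers of $G$ in the groups $\mathrm{Aut}(T)$, $\mathrm{Homeo}(\partial T)$, $\mathrm{Aut}(\partial T,\mu)$, $\widetilde{\mathrm{Aut}}(\partial T,\mu)$ and $\mathrm{Aut}(\partial T)$ are trivial.
   Context: A rooted tree is an infinite tree $T$ with vertex set divided into levels $V_n$, $n\in\mathbb{Z}_{\geq 0}$, such that $V_0=\{v_0\}$ consists of one vertex (the root), edges join only consecutive levels, and each vertex of $V_n$ ($n\geq 1$) is joined to exactly one vertex of $V_{n-1}$. $T$ is spherically homogeneous if, for each $n$, every vertex of $V_n$ is joined to the same finite number $d_n\geq 1$ of vertices of $V_{n+1}$. $\mathrm{Aut}(T)$ is the group of graph automorphisms of $T$ fixing the root. The boundary $\partial T$ is the set of infinite paths starting at $v_0$ and passing through each level exactly once, with the topology generated by the sets $\partial T_v$ of paths passing through a vertex $v$; $\mathrm{Aut}(T)$ acts on it by homeomorphisms. For a vertex $v$, $T_v$ is the subtree of all descendants of $v$ (including $v$). A subgroup $G<\mathrm{Aut}(T)$ is weakly branch if it acts transitively on each level $V_n$ and, for every vertex $v$, the subgroup of all $g\in G$ fixing every vertex outside $T_v$ is nontrivial. $\mu$ is the unique $G$-invariant Borel probability measure on $\partial T$, given by $\mu(\partial T_v)=\frac{1}{d_0d_1\cdots d_{n-1}}$ for $v\in V_n$. $\mathrm{Homeo}(\partial T)$ is the group of homeomorphisms of $\partial T$ onto itself; $\mathrm{Aut}(\partial T)$ is the group of Borel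 automorphisms of $\partial T$; $\mathrm{Aut}(\partial T,\mu)$ and $\widetilde{\mathrm{Aut}}(\partial T,\mu)$ are the groups of all measure preserving, respectively measure class preserving, automorphisms of the measure space $(\partial T,\mu)$, where (as usual) maps that agree $\mu$-almost everywhere are identified. $G$ is regarded as a subgroup of each of these groups through its action. The centralizer of $G$ in $H$ is $C_H(G)=\{h\in H: hg=gh \text{ for all } g\in G\}$. *)

theory Defs
  imports "HOL-Probability.Probability_Measure" "HOL-Algebra.Coset" "HOL-Algebra.Bij"
begin

section \<open>Rooted trees\<close>

record 'v levelled_graph =
  level :: "nat \<Rightarrow> 'v set"
  adj :: "'v \<Rightarrow> 'v \<Rightarrow> bool"

definition verts :: "'v levelled_graph \<Rightarrow> 'v set" where
  "verts T = (\<Union>n. level T n)"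

text \<open>
  Connectedness and acyclicity need not be demanded: every vertex is joined to the root through
  its chain of parents, and a vertex of maximal level on a cycle would have two parents.
\<close>

definition rooted_tree :: "'v levelled_graph \<Rightarrow> bool" where
  "rooted_tree T \<longleftrightarrow>
     infinite (verts T) \<and>
     (\<exists>v0. level T 0 = {v0}) \<and>
     (\<forall>m n. m \<noteq> n \<longrightarrow> level T m \<inter> level T n = {}) \<and>
     (\<forall>u v. adj T u v \<longrightarrow> adj T v u) \<and>
     (\<forall>u v. adj T u v \<longrightarrow> (\<exists>n. u \<in> level T n \<and> v \<in> level T (Suc n) \<or>
                                 v \<in> level T n \<and> u \<in> level T (Suc n))) \<and>
     (\<forall>n. \<forall>v \<in> level T (Suc n). \<exists>!u. u \<in> level T n \<and> adj T u v)"

definition spherically_homogeneous :: "'v levelled_graph \<Rightarrow> (nat \<Rightarrow> nat) \<Rightarrow> bool" where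
  "spherically_homogeneous T d \<longleftrightarrow>
     (\<forall>n. d n \<ge> 1 \<and>
       (\<forall>v \<in> level T n. finite {w \<in> level T (Suc n). adj T v w} \<and>
                        card {w \<in> level T (Suc n). adj T v w} = d n))"

definition child :: "'v levelled_graph \<Rightarrow> 'v \<Rightarrow> 'v \<Rightarrow> bool" where
  "child T v w \<longleftrightarrow> (\<exists>n. v \<in> level T n \<and> w \<in> level T (Suc n) \<and> adj T v w)"

definition descendants :: "'v levelled_graph \<Rightarrow> 'v \<Rightarrow> 'v set" where
  "descendants T v = {w. (child T)\<^sup>*\<^sup>* v w}"


section \<open>Automorphisms of the tree and weakly branch groups\<close>

definition tree_aut_group :: "'v levelled_graph \<Rightarrow> ('v \<Rightarrow> 'v) monoid" where
  "tree_aut_group T = (BijGroup (verts T))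
     \<lparr>carrier := {g \<in> Bij (verts T).
        (\<forall>u \<in> verts T. \<forall>v \<in> verts T. adj T (g u) (g v) \<longleftrightarrow> adj T u v) \<and>
        (\<forall>v \<in> level T 0. g v = v)}\<rparr>"

definition rigid_stabilizer :: "'v levelled_graph \<Rightarrow> ('v \<Rightarrow> 'v) set \<Rightarrow> 'v \<Rightarrow> ('v \<Rightarrow> 'v) set" where
  "rigid_stabilizer T G v = {g \<in> G. \<forall>u \<in> verts T - descendants T v. g u = u}"

definition weakly_branch :: "'v levelled_graph \<Rightarrow> ('v \<Rightarrow> 'v) set \<Rightarrow> bool" where
  "weakly_branch T G \<longleftrightarrow>
     subgroup G (tree_aut_group T) \<and>
     (\<forall>n. \<forall>u \<in> level T n. \<forall>v \<in> level T n. \<exists>g \<in> G. g u = v) \<and>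
     (\<forall>v \<in> verts T. rigid_stabilizer T G v \<noteq> {\<one>\<^bsub>tree_aut_group T\<^esub>})"


section \<open>The boundary\<close>

definition boundary :: "'v levelled_graph \<Rightarrow> (nat \<Rightarrow> 'v) set" where
  "boundary T = {p. \<forall>n. p n \<in> level T n \<and> adj T (p n) (p (Suc n))}"

definition cylinder :: "'v levelled_graph \<Rightarrow> 'v \<Rightarrow> (nat \<Rightarrow> 'v) set" where
  "cylinder T v = {p \<in> boundary T. \<exists>n. p n = v}"

definition boundary_topology :: "'v levelled_graph \<Rightarrow> (nat \<Rightarrow> 'v) topology" where
  "boundary_topology T = topology_generated_by (cylinder T ` verts T)"

text \<open>
  A \<open>measure\<close> that only serves to carry the Borel sets of the boundary
  (\<^term>\<open>sigma\<close> equips them with the zero measure).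
\<close>

definition boundary_borel :: "'v levelled_graph \<Rightarrow> (nat \<Rightarrow> 'v) measure" where
  "boundary_borel T = sigma (boundary T) {U. openin (boundary_topology T) U}"

text \<open>The cylinders generate the Borel sets, so at most one \<open>\<mu>\<close> satisfies the following.\<close>

definition uniform_boundary_measure ::
    "'v levelled_graph \<Rightarrow> (nat \<Rightarrow> nat) \<Rightarrow> (nat \<Rightarrow> 'v) measure \<Rightarrow> bool" where
  "uniform_boundary_measure T d \<mu> \<longleftrightarrow>
     prob_space \<mu> \<and> sets \<mu> = sets (boundary_borel T) \<and>
     (\<forall>n. \<forall>v \<in> level T n. measure \<mu> (cylinder T v) = 1 / real (\<Prod>i<n. d i))"

definition boundary_map :: "'v levelled_graph \<Rightarrow> ('v \<Rightarrow> 'v) \<Rightarrow> (nat \<Rightarrow> 'v) \<Rightarrow> (nat \<Rightarrow> 'v)" where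
  "boundary_map T g = (\<lambda>p \<in> boundary T. \<lambda>n. g (p n))"


section \<open>Groups of transformations of the boundary\<close>

definition homeo_group :: "'v levelled_graph \<Rightarrow> ((nat \<Rightarrow> 'v) \<Rightarrow> (nat \<Rightarrow> 'v)) monoid" where
  "homeo_group T = (BijGroup (boundary T))
     \<lparr>carrier := {h \<in> Bij (boundary T).
        homeomorphic_map (boundary_topology T) (boundary_topology T) h}\<rparr>"

definition borel_aut_group :: "'v levelled_graph \<Rightarrow> ((nat \<Rightarrow> 'v) \<Rightarrow> (nat \<Rightarrow> 'v)) monoid" where
  "borel_aut_group T = (BijGroup (boundary T))
     \<lparr>carrier := {h \<in> Bij (boundary T).
        h \<in> boundary_borel T \<rightarrow>\<^sub>M boundary_borel T \<and>
        inv_into (boundary T) h \<in> boundary_borel T \<rightarrow>\<^sub>M boundary_borel T}\<rparr>"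

text \<open>
  The next two groups consist of genuine Borel automorphisms; the identification of maps that agree
  almost everywhere is the quotient by the normal subgroup \<open>ae_trivial\<close>.
\<close>

definition mp_borel_aut_group ::
    "'v levelled_graph \<Rightarrow> (nat \<Rightarrow> 'v) measure \<Rightarrow> ((nat \<Rightarrow> 'v) \<Rightarrow> (nat \<Rightarrow> 'v)) monoid" where
  "mp_borel_aut_group T \<mu> = (borel_aut_group T)
     \<lparr>carrier := {h \<in> carrier (borel_aut_group T). distr \<mu> \<mu> h = \<mu>}\<rparr>"

definition mcp_borel_aut_group ::
    "'v levelled_graph \<Rightarrow> (nat \<Rightarrow> 'v) measure \<Rightarrow> ((nat \<Rightarrow> 'v) \<Rightarrow> (nat \<Rightarrow> 'v)) monoid" where
  "mcp_borel_aut_group T \<mu> = (borel_aut_group T)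
     \<lparr>carrier := {h \<in> carrier (borel_aut_group T). null_sets (distr \<mu> \<mu> h) = null_sets \<mu>}\<rparr>"

definition ae_trivial :: "'x measure \<Rightarrow> ('x \<Rightarrow> 'x) monoid \<Rightarrow> ('x \<Rightarrow> 'x) set" where
  "ae_trivial \<mu> H = {h \<in> carrier H. AE x in \<mu>. h x = x}"

definition ae_quotient :: "'x measure \<Rightarrow> ('x \<Rightarrow> 'x) monoid \<Rightarrow> ('x \<Rightarrow> 'x) set monoid" where
  "ae_quotient \<mu> H = H Mod ae_trivial \<mu> H"

definition ae_class :: "'x measure \<Rightarrow> ('x \<Rightarrow> 'x) monoid \<Rightarrow> ('x \<Rightarrow> 'x) \<Rightarrow> ('x \<Rightarrow> 'x) set" where
  "ae_class \<mu> H h = ae_trivial \<mu> H #>\<^bsub>H\<^esub> h"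

abbreviation mp_aut_group ::
    "'v levelled_graph \<Rightarrow> (nat \<Rightarrow> 'v) measure \<Rightarrow> ((nat \<Rightarrow> 'v) \<Rightarrow> (nat \<Rightarrow> 'v)) set monoid" where
  "mp_aut_group T \<mu> \<equiv> ae_quotient \<mu> (mp_borel_aut_group T \<mu>)"

abbreviation mcp_aut_group ::
    "'v levelled_graph \<Rightarrow> (nat \<Rightarrow> 'v) measure \<Rightarrow> ((nat \<Rightarrow> 'v) \<Rightarrow> (nat \<Rightarrow> 'v)) set monoid" where
  "mcp_aut_group T \<mu> \<equiv> ae_quotient \<mu> (mcp_borel_aut_group T \<mu>)"


section \<open>Centralizers\<close>

definition centralizer :: "('a, 'b) monoid_scheme \<Rightarrow> 'a set \<Rightarrow> 'a set" where
  "centralizer H S = {h \<in> carrier H. \<forall>g \<in> S. h \<otimes>\<^bsub>H\<^esub> g = g \<otimes>\<^bsub>H\<^esub> h}"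

end

theory Submission
  imports Defs
begin

text \<open>
  Stabilizers in a weakly branch group separate boundary points: given \<open>p \<noteq> q\<close>, take a vertex \<open>v\<close> on
  \<open>q\<close> but not on \<open>p\<close>. A nontrivial element of the rigid stabilizer of \<open>v\<close> moves some descendant \<open>u\<close>
  of \<open>v\<close>, and conjugating it by an element of \<open>G\<close> that takes \<open>u\<close> to a vertex of \<open>q\<close> produces an
  element that moves \<open>q\<close> but fixes \<open>p\<close>. If \<open>h\<close> commutes with \<open>G\<close> at \<open>p\<close>, every element of \<open>G\<close>
  fixing \<open>p\<close> fixes \<open>h p\<close>, so \<open>h p = p\<close>. No regularity of \<open>h\<close> enters, and since \<open>G\<close> is countable
  the argument works at almost every point when \<open>h\<close> commutes with each element of \<open>G\<close> only almost
  everywhere.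
\<close>

section \<open>Subgroups of the symmetric group\<close>

text \<open>The closure conditions are phrased with \<open>compose\<close> and restricted inverses,
  the concrete operations of \<open>BijGroup\<close>, so that tree automorphisms and both groups of
  measure space automorphisms can be checked pointwise.\<close>

lemma subgroup_BijGroupI:
  assumes "K \<subseteq> Bij S" and "(\<lambda>x\<in>S. x) \<in> K"
    and "\<And>f g. f \<in> K \<Longrightarrow> g \<in> K \<Longrightarrow> compose S f g \<in> K"
    and "\<And>f. f \<in> K \<Longrightarrow> restrict (inv_into S f) S \<in> K"
  shows "subgroup K (BijGroup S)"
proof (rule group.subgroupI[OF group_BijGroup])
  show "inv\<^bsub>BijGroup S\<^esub> f \<in> K" if "f \<in> K" for f
    using that assms(1,4) by (simp add: inv_BijGroup subset_iff)
  show "f \<otimes>\<^bsub>BijGroup S\<^esub> g \<in> K" if "f \<in> K" "g \<in> K" for f g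
    using that assms(1,3) by (simp add: BijGroup_def subset_iff)
qed (use assms in \<open>auto simp: BijGroup_def\<close>)

lemma Bij_bij_betw: "f \<in> Bij S \<Longrightarrow> bij_betw f S S"
  by (simp add: Bij_def)

lemma Bij_eqI:
  assumes "f \<in> Bij S" "g \<in> Bij S" "\<And>x. x \<in> S \<Longrightarrow> f x = g x"
  shows "f = g"
  using assms by (auto simp: Bij_def intro: extensionalityI)

lemma Bij_inv_into:
  assumes "f \<in> Bij S" "x \<in> S"
  shows "inv_into S f x \<in> S" "f (inv_into S f x) = x" "inv_into S f (f x) = x" "f x \<in> S"
  using assms(2) bij_betw_inv_into_left[OF Bij_bij_betw[OF assms(1)]]
    bij_betw_inv_into_right[OF Bij_bij_betw[OF assms(1)]]
    Bij_inv_into_mem[OF assms(1)] funcset_mem[OF Bij_imp_funcset[OF assms(1)]] by simp_all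

text \<open>The inverse in \<open>BijGroup\<close> is the restricted \<open>inv_into\<close>, while
  measurability of inverses is demanded for the unrestricted one; on \<open>S\<close> the two
  conventions are reconciled here.\<close>

lemma inv_into_restrict_inv_into:
  assumes "f \<in> Bij S" "x \<in> S"
  shows "inv_into S (restrict (inv_into S f) S) x = f x"
  using Bij_inv_into(3)[OF restrict_inv_into_Bij[OF assms(1)] Bij_inv_into(4)[OF assms]]
    Bij_inv_into[OF assms] by simp

lemma inv_into_compose_Bij:
  assumes f: "f \<in> Bij S" and g: "g \<in> Bij S" and x: "x \<in> S"
  shows "inv_into S (compose S f g) x = inv_into S g (inv_into S f x)"
proof -
  let ?y = "inv_into S g (inv_into S f x)"
  have y: "?y \<in> S" "compose S f g ?y = x"
    using f g x by (simp_all add: Bij_inv_into compose_eq)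
  show ?thesis
    using Bij_inv_into(3)[OF compose_Bij[OF f g] y(1)] y(2) by simp
qed

section \<open>Vertices and descendants\<close>

locale tree =
  fixes T :: "'v levelled_graph"
  assumes rooted: "rooted_tree T"
begin

abbreviation "V \<equiv> verts T"
abbreviation "L \<equiv> level T"
abbreviation "Aut \<equiv> carrier (tree_aut_group T)"

lemma level_verts: "v \<in> L n \<Longrightarrow> v \<in> V"
  by (auto simp: verts_def)

lemma level_unique: "v \<in> L n \<Longrightarrow> v \<in> L m \<Longrightarrow> m = n"
  using rooted by (auto simp: rooted_tree_def disjoint_iff)

lemma root_level: "\<exists>r. L 0 = {r}"
  using rooted by (simp add: rooted_tree_def)

lemma adj_levels:
  "adj T u v \<Longrightarrow> \<exists>n. u \<in> L n \<and> v \<in> L (Suc n) \<or> v \<in> L n \<and> u \<in> L (Suc n)"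
  using rooted by (simp add: rooted_tree_def)

lemma adj_sym: "adj T u v \<Longrightarrow> adj T v u"
  using rooted by (simp add: rooted_tree_def)

lemma parent_ex1: "v \<in> L (Suc n) \<Longrightarrow> \<exists>!u. u \<in> L n \<and> adj T u v"
  using rooted by (simp add: rooted_tree_def)

lemma parent_exists: "v \<in> L (Suc n) \<Longrightarrow> \<exists>u. u \<in> L n \<and> adj T u v"
  using parent_ex1 by blast

lemma parent_unique:
  "v \<in> L (Suc n) \<Longrightarrow> u \<in> L n \<Longrightarrow> adj T u v \<Longrightarrow> u' \<in> L n \<Longrightarrow> adj T u' v \<Longrightarrow> u = u'"
  using parent_ex1 by blast

lemma child_parent_unique: "child T u v \<Longrightarrow> child T u' v \<Longrightarrow> u = u'"
  unfolding child_def using level_unique parent_unique by (metis nat.inject)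

lemma child_level: "child T u v \<Longrightarrow> u \<in> L n \<Longrightarrow> v \<in> L (Suc n)"
  unfolding child_def using level_unique by blast

lemma descendant_level:
  assumes "(child T)\<^sup>*\<^sup>* v u" "v \<in> L n"
  shows "u = v \<or> (\<exists>m>n. u \<in> L m)"
  using assms
proof (induction rule: rtranclp_induct)
  case (step y z)
  then show ?case using child_level by (metis less_SucI lessI)
qed simp

text \<open>Parents are unique, so two descending chains that end in the same vertex coincide when
  followed back towards the root and pass through the same vertex of level \<open>n\<close>.\<close>

lemma ancestor_unique:
  assumes "(child T)\<^sup>*\<^sup>* v u" "(child T)\<^sup>*\<^sup>* v' u" "v \<in> L n" "v' \<in> L n"
  shows "v = v'"
  using assms
proof (induction rule: rtranclp_induct)
  case base
  then show ?case using descendant_level level_unique by (metis nat_neq_iff)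
next
  case (step y z)
  \<comment> \<open>The vertex \<open>z\<close> is strictly deeper than level \<open>n\<close>, so
    the chain from \<open>v'\<close> to \<open>z\<close> is nonempty and its last step leaves the
    unique parent of \<open>z\<close>.\<close>
  have "z \<noteq> v'"
    using descendant_level[OF step.hyps(1) step.prems(2)] child_level[OF step.hyps(2)] step.prems
      level_unique by (metis less_not_refl2 lessI less_SucI)
  with step.prems(1) obtain y' where "(child T)\<^sup>*\<^sup>* v' y'" "child T y' z"
    by (metis rtranclp.cases)
  with step show ?case using child_parent_unique by metis
qed

section \<open>Tree automorphisms\<close>

lemma Aut_Bij: "g \<in> Aut \<Longrightarrow> g \<in> Bij V"
  by (simp add: tree_aut_group_def)

lemma Aut_adj: "g \<in> Aut \<Longrightarrow> u \<in> V \<Longrightarrow> v \<in> V \<Longrightarrow> adj T (g u) (g v) \<longleftrightarrow> adj T u v"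
  by (simp add: tree_aut_group_def)

lemma Aut_root: "g \<in> Aut \<Longrightarrow> v \<in> L 0 \<Longrightarrow> g v = v"
  by (simp add: tree_aut_group_def)

lemma subgroup_Aut: "subgroup Aut (BijGroup V)"
proof (rule subgroup_BijGroupI)
  show "Aut \<subseteq> Bij V" using Aut_Bij by blast
  show "(\<lambda>x\<in>V. x) \<in> Aut"
    by (simp add: tree_aut_group_def id_Bij level_verts)
  fix f assume f: "f \<in> Aut"
  note fB = Bij_inv_into[OF Aut_Bij[OF f]]
  have "adj T (inv_into V f u) (inv_into V f v) = adj T u v" if "u \<in> V" "v \<in> V" for u v
    using Aut_adj[OF f, of "inv_into V f u" "inv_into V f v"] fB that by simp
  moreover have "inv_into V f v = v" if "v \<in> L 0" for v
    using fB(3)[of v] Aut_root[OF f that] level_verts[OF that] by simp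
  ultimately show "restrict (inv_into V f) V \<in> Aut"
    using restrict_inv_into_Bij[OF Aut_Bij[OF f]] by (simp add: tree_aut_group_def level_verts)
  fix g assume g: "g \<in> Aut"
  note gB = Bij_inv_into[OF Aut_Bij[OF g]]
  show "compose V f g \<in> Aut"
    using f g compose_Bij[OF Aut_Bij[OF f] Aut_Bij[OF g]] gB(4)
    by (simp add: tree_aut_group_def level_verts compose_eq)
qed

lemma group_Aut: "group (tree_aut_group T)"
proof -
  have "BijGroup V\<lparr>carrier := Aut\<rparr> = tree_aut_group T"
    by (simp add: tree_aut_group_def)
  then show ?thesis
    using group.subgroup_imp_group[OF group_BijGroup subgroup_Aut] by metis
qed

lemma Aut_mult: "f \<in> Aut \<Longrightarrow> g \<in> Aut \<Longrightarrow> f \<otimes>\<^bsub>tree_aut_group T\<^esub> g = compose V f g"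
  using Aut_Bij[of f] Aut_Bij[of g] by (simp add: tree_aut_group_def BijGroup_def)

lemma Aut_one: "\<one>\<^bsub>tree_aut_group T\<^esub> = (\<lambda>v\<in>V. v)"
  by (simp add: tree_aut_group_def BijGroup_def)

lemma Aut_inv:
  assumes "g \<in> Aut" "v \<in> V"
  shows "g (m_inv (tree_aut_group T) g v) = v" "m_inv (tree_aut_group T) g (g v) = v"
    "m_inv (tree_aut_group T) g v \<in> V"
proof -
  let ?i = "m_inv (tree_aut_group T) g"
  have i: "?i \<in> Aut" using group.inv_closed[OF group_Aut] assms by blast
  have "compose V g ?i = (\<lambda>v\<in>V. v)" "compose V ?i g = (\<lambda>v\<in>V. v)"
    using group.r_inv[OF group_Aut assms(1)] group.l_inv[OF group_Aut assms(1)] i assms(1)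
    by (simp_all add: Aut_mult Aut_one)
  then show "g (?i v) = v" "?i (g v) = v"
    using assms(2) by (metis compose_eq restrict_apply')+
  show "?i v \<in> V" using Bij_inv_into(4)[OF Aut_Bij[OF i] assms(2)] .
qed

text \<open>By induction \<open>g\<close> preserves the levels of the parent \<open>u\<close> and the grandparent \<open>t\<close> of \<open>v\<close>.
  If \<open>g v\<close> were above \<open>g u\<close>, it would be the parent of \<open>g u\<close>, and so would \<open>g t\<close>.\<close>

lemma Aut_level:
  assumes g: "g \<in> Aut"
  shows "v \<in> L n \<Longrightarrow> g v \<in> L n"
proof (induction n arbitrary: v rule: less_induct)
  case (less n)
  show ?case
  proof (cases n)
    case 0
    then show ?thesis using Aut_root[OF g] less.prems by simp
  next
    case (Suc m)
    obtain u where u: "u \<in> L m" "adj T u v" using parent_exists[of v m] less.prems Suc by auto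
    have gu: "g u \<in> L m" using less.IH[of m] u(1) Suc by simp
    have uv: "adj T (g u) (g v)"
      using Aut_adj[OF g level_verts[OF u(1)] level_verts[OF less.prems]] u(2) by simp
    have False if gv: "g v \<in> L k" and k: "m = Suc k" for k
    proof -
      obtain t where t: "t \<in> L k" "adj T t u" using parent_exists[of u k] u k by auto
      have gt: "g t \<in> L k" using less.IH[of k] t(1) Suc k by simp
      have "adj T (g t) (g u)"
        using Aut_adj[OF g level_verts[OF t(1)] level_verts[OF u(1)]] t(2) by simp
      then have "g t = g v"
        using parent_unique[of "g u" k] gt gu gv k adj_sym[OF uv] by simp
      then have "t = v"
        using level_verts[OF t(1)] level_verts[OF less.prems]
        by (rule inj_onD[OF bij_betw_imp_inj_on[OF Bij_bij_betw[OF Aut_Bij[OF g]]]])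
      then show False using level_unique[of v k n] t(1) less.prems Suc k by simp
    qed
    note not_down = this
    obtain k where "g u \<in> L k \<and> g v \<in> L (Suc k) \<or> g v \<in> L k \<and> g u \<in> L (Suc k)"
      using adj_levels[OF uv] by blast
    then show ?thesis
    proof
      assume "g u \<in> L k \<and> g v \<in> L (Suc k)"
      then show ?thesis using level_unique[OF gu, of k] Suc by simp
    next
      assume "g v \<in> L k \<and> g u \<in> L (Suc k)"
      then show ?thesis using not_down[of k] level_unique[OF gu, of "Suc k"] by simp
    qed
  qed
qed

lemma Aut_descendant:
  assumes g: "g \<in> Aut" and "(child T)\<^sup>*\<^sup>* v u"
  shows "(child T)\<^sup>*\<^sup>* (g v) (g u)"
  using assms(2)
proof (induction rule: rtranclp_induct)
  case (step y z)
  have "child T (g y) (g z)"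
    using step.hyps(2) Aut_level[OF g] Aut_adj[OF g] level_verts unfolding child_def by metis
  then show ?case using step.IH by simp
qed simp

end

section \<open>Rigid stabilizers\<close>

locale weakly_branch_tree = tree T for T :: "'v levelled_graph" +
  fixes G :: "('v \<Rightarrow> 'v) set"
  assumes weakly_branch: "weakly_branch T G"
begin

lemma G_subgroup: "subgroup G (tree_aut_group T)"
  using weakly_branch by (simp add: weakly_branch_def)

lemma G_Aut: "g \<in> G \<Longrightarrow> g \<in> Aut"
  using subgroup.mem_carrier[OF G_subgroup] .

lemma G_transitive: "u \<in> L n \<Longrightarrow> v \<in> L n \<Longrightarrow> \<exists>g\<in>G. g u = v"
  using weakly_branch by (simp add: weakly_branch_def)

text \<open>The identity lies in the rigid stabilizer, so differing from the trivial group provides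
  a nontrivial element; a vertex moved by it cannot lie outside the descendants of
  \<open>v\<close>.\<close>

lemma rigid_stabilizer_moves:
  assumes "v \<in> V"
  obtains g u where "g \<in> rigid_stabilizer T G v" "u \<in> V" "(child T)\<^sup>*\<^sup>* v u" "g u \<noteq> u"
proof -
  let ?R = "rigid_stabilizer T G v" and ?id = "\<one>\<^bsub>tree_aut_group T\<^esub>"
  have "?id \<in> ?R"
    using subgroup.one_closed[OF G_subgroup] by (simp add: rigid_stabilizer_def Aut_one)
  moreover have "?R \<noteq> {?id}" using weakly_branch assms by (simp add: weakly_branch_def)
  ultimately obtain g where g: "g \<in> ?R" "g \<noteq> ?id" by blast
  have gG: "g \<in> G" using g(1) by (simp add: rigid_stabilizer_def)
  have "g \<in> Bij V" "?id \<in> Bij V"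
    using Aut_Bij G_Aut gG subgroup.one_closed[OF G_subgroup] by blast+
  with g(2) obtain u where u: "u \<in> V" "g u \<noteq> u"
    using Bij_eqI[of g V ?id] by (auto simp: Aut_one)
  then have "(child T)\<^sup>*\<^sup>* v u" using g(1) by (auto simp: rigid_stabilizer_def descendants_def)
  then show thesis using that g(1) u by blast
qed

text \<open>Conjugating by an element of \<open>G\<close> that takes \<open>u\<close> to \<open>p m\<close> does not leave the rigid
  stabilizer, because such an element fixes the common ancestor \<open>v\<close>.\<close>

lemma rigid_stabilizer_moves_path:
  assumes v: "v \<in> L n" and p: "\<And>m. m \<ge> n \<Longrightarrow> p m \<in> L m \<and> (child T)\<^sup>*\<^sup>* v (p m)"
  obtains g m where "g \<in> rigid_stabilizer T G v" "g (p m) \<noteq> p m"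
proof -
  obtain g u where g: "g \<in> rigid_stabilizer T G v" and u: "u \<in> V" "(child T)\<^sup>*\<^sup>* v u" "g u \<noteq> u"
    using rigid_stabilizer_moves[OF level_verts[OF v]] .
  obtain m where m: "u \<in> L m" "m \<ge> n"
    using descendant_level[OF u(2) v] v by force
  note pm = p[OF m(2)]
  obtain h where h: "h \<in> G" "h u = p m" using G_transitive m(1) pm by blast
  let ?i = "m_inv (tree_aut_group T) h"
  have iG: "?i \<in> G" using subgroup.m_inv_closed[OF G_subgroup h(1)] .
  note i = Aut_inv[OF G_Aut[OF h(1)]]
  have gG: "g \<in> G" using g by (simp add: rigid_stabilizer_def)
  have hv: "h v = v"
    using ancestor_unique[OF _ conjunct2[OF pm] Aut_level[OF G_Aut[OF h(1)] v] v]
      Aut_descendant[OF G_Aut[OF h(1)] u(2)] h(2) by simp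
  define k where "k = compose V h (compose V g ?i)"
  have k_apply: "k w = h (g (?i w))" if "w \<in> V" for w
    using that by (simp add: k_def compose_eq)
  have "k = h \<otimes>\<^bsub>tree_aut_group T\<^esub> (g \<otimes>\<^bsub>tree_aut_group T\<^esub> ?i)"
    using subgroup.m_closed[OF G_subgroup gG iG] gG iG h(1) by (simp add: k_def Aut_mult G_Aut)
  then have "k \<in> G"
    using subgroup.m_closed[OF G_subgroup] gG iG h(1) by simp
  moreover have "k w = w" if w: "w \<in> V - descendants T v" for w
  proof -
    \<comment> \<open>Otherwise \<open>h\<close>, which fixes \<open>v\<close> and preserves
      descent, would make \<open>w\<close> a descendant of \<open>v\<close>.\<close>
    have "\<not> (child T)\<^sup>*\<^sup>* v (?i w)"
      using Aut_descendant[OF G_Aut[OF h(1)], of v "?i w"] hv i(1)[of w] w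
      by (auto simp: descendants_def)
    then have "g (?i w) = ?i w"
      using g i(3)[of w] w by (auto simp: rigid_stabilizer_def descendants_def)
    then show ?thesis using k_apply i(1) w by simp
  qed
  ultimately have "k \<in> rigid_stabilizer T G v" by (simp add: rigid_stabilizer_def)
  moreover have "k (p m) \<noteq> p m"
  proof
    assume "k (p m) = p m"
    then have "h (g u) = h u"
      using k_apply[of "p m"] level_verts pm i(2)[OF u(1)] h(2) by auto
    then have "g u = u"
      using i(2)[OF u(1)] i(2)[OF Bij_inv_into(4)[OF Aut_Bij[OF G_Aut[OF gG]] u(1)]] by simp
    then show False using u(3) by simp
  qed
  ultimately show thesis using that by blast
qed

section \<open>Separation of boundary points, and the centralizer in the tree automorphisms\<close>

lemma boundary_descendant:
  assumes "p \<in> boundary T" "n \<le> m"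
  shows "(child T)\<^sup>*\<^sup>* (p n) (p m)"
  using assms(2)
proof (induction rule: dec_induct)
  case (step m)
  have "child T (p m) (p (Suc m))" using assms(1) by (auto simp: child_def boundary_def)
  then show ?case using step.IH by simp
qed simp

text \<open>The hypothesis \<open>stab\<close> is what commutation supplies when \<open>q\<close> is
  the image of \<open>p\<close>; the four centralizers of maps on the boundary all rest on
  this.\<close>

lemma stabilizers_separate_boundary:
  assumes p: "p \<in> boundary T" and q: "q \<in> boundary T"
    and stab: "\<And>g. g \<in> G \<Longrightarrow> boundary_map T g p = p \<Longrightarrow> boundary_map T g q = q"
  shows "p = q"
proof (rule ccontr)
  assume "p \<noteq> q"
  then obtain n where n: "p n \<noteq> q n" by blast
  have pL: "p m \<in> L m" and qL: "q m \<in> L m" for m using p q by (auto simp: boundary_def)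
  obtain g m where g: "g \<in> rigid_stabilizer T G (q n)" and gq: "g (q m) \<noteq> q m"
    using rigid_stabilizer_moves_path[OF qL[of n], of q] qL boundary_descendant[OF q] by blast
  \<comment> \<open>A vertex of \<open>p\<close> descending from \<open>q n\<close> would have level
    at least \<open>n\<close>, and hence both \<open>p n\<close> and \<open>q n\<close> as ancestors
    on level \<open>n\<close>.\<close>
  have "p m \<notin> descendants T (q n)" for m
  proof
    assume "p m \<in> descendants T (q n)"
    then have *: "(child T)\<^sup>*\<^sup>* (q n) (p m)" by (simp add: descendants_def)
    have "n \<le> m"
      using descendant_level[OF * qL] level_unique pL qL by (metis less_imp_le order_refl)
    then show False
      using ancestor_unique[OF * boundary_descendant[OF p] qL pL] n by auto
  qed
  then have "g (p m) = p m" for m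
    using g level_verts[OF pL] by (auto simp: rigid_stabilizer_def)
  then have "boundary_map T g p = p" using p by (simp add: boundary_map_def)
  then have "boundary_map T g q = q" using stab g by (simp add: rigid_stabilizer_def)
  then show False using gq q by (auto simp: boundary_map_def dest: fun_cong)
qed

text \<open>Here vertices take the place of boundary points. If \<open>h v\<close> differs from
  \<open>v\<close>, the subtrees below them are disjoint, and an element rigid at \<open>h v\<close>
  that moves some \<open>u\<close> fixes the preimage of \<open>u\<close> under \<open>h\<close>,
  which lies below \<open>v\<close>. Commuting with \<open>h\<close> then forces it to fix
  \<open>u\<close> as well.\<close>

lemma centralizer_Aut: "centralizer (tree_aut_group T) G = {\<one>\<^bsub>tree_aut_group T\<^esub>}"
proof (intro subset_antisym subsetI)
  interpret A: group "tree_aut_group T" by (rule group_Aut)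
  show "h \<in> centralizer (tree_aut_group T) G" if "h \<in> {\<one>\<^bsub>tree_aut_group T\<^esub>}" for h
    using that G_Aut by (auto simp: centralizer_def)
  fix h assume "h \<in> centralizer (tree_aut_group T) G"
  then have h: "h \<in> Aut" and "\<And>g. g \<in> G \<Longrightarrow> compose V h g = compose V g h"
    using G_Aut by (auto simp: centralizer_def Aut_mult)
  then have comm: "h (g v) = g (h v)" if "g \<in> G" "v \<in> V" for g v
    using that by (metis compose_eq)
  have "h v = v" if v: "v \<in> L n" for v n
  proof (rule ccontr)
    assume hv: "h v \<noteq> v"
    note hvL = Aut_level[OF h v]
    obtain g u where g: "g \<in> rigid_stabilizer T G (h v)"
      and u: "u \<in> V" "(child T)\<^sup>*\<^sup>* (h v) u" "g u \<noteq> u"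
      using rigid_stabilizer_moves[OF level_verts[OF hvL]] .
    let ?i = "inv\<^bsub>tree_aut_group T\<^esub> h"
    note i = Aut_inv[OF h]
    have "(child T)\<^sup>*\<^sup>* v (?i u)"
      using Aut_descendant[OF A.inv_closed[OF h] u(2)] i(2)[OF level_verts[OF v]] by simp
    then have "?i u \<notin> descendants T (h v)"
      using ancestor_unique[OF _ _ v hvL] hv by (auto simp: descendants_def)
    then have "g (?i u) = ?i u" using g i(3)[OF u(1)] by (simp add: rigid_stabilizer_def)
    then have "g u = u"
      using comm[of g "?i u"] i(1,3)[OF u(1)] g by (simp add: rigid_stabilizer_def)
    then show False using u(3) by simp
  qed
  then have "h = \<one>\<^bsub>tree_aut_group T\<^esub>"
    using Bij_eqI[OF Aut_Bij[OF h] Aut_Bij[OF A.one_closed]] by (auto simp: Aut_one verts_def)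
  then show "h \<in> {\<one>\<^bsub>tree_aut_group T\<^esub>}" by simp
qed

end

section \<open>Groups of Borel automorphisms and almost everywhere equality\<close>

text \<open>Measure preserving and measure class preserving automorphisms are both instances, so the
  quotient by almost everywhere equality is treated once. The condition on null sets allows almost
  everywhere statements to be pulled back along elements of \<open>K\<close>.\<close>

locale measure_class_group =
  fixes \<mu> :: "'x measure" and K :: "('x \<Rightarrow> 'x) set"
  assumes K_subgroup: "subgroup K (BijGroup (space \<mu>))"
    and K_measurable: "h \<in> K \<Longrightarrow> h \<in> \<mu> \<rightarrow>\<^sub>M \<mu>"
    and K_null_sets: "h \<in> K \<Longrightarrow> null_sets (distr \<mu> \<mu> h) = null_sets \<mu>"
begin

abbreviation "H \<equiv> BijGroup (space \<mu>)\<lparr>carrier := K\<rparr>"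
abbreviation "N \<equiv> ae_trivial \<mu> H"

sublocale H: group H
  using group.subgroup_imp_group[OF group_BijGroup K_subgroup] .

lemma K_Bij: "h \<in> K \<Longrightarrow> h \<in> Bij (space \<mu>)"
  using subgroup.mem_carrier[OF K_subgroup] by (simp add: BijGroup_def)

lemma mult_apply: "f \<in> K \<Longrightarrow> g \<in> K \<Longrightarrow> x \<in> space \<mu> \<Longrightarrow> (f \<otimes>\<^bsub>H\<^esub> g) x = f (g x)"
  using K_Bij[of f] K_Bij[of g] by (simp add: BijGroup_def compose_eq)

lemma one_apply: "x \<in> space \<mu> \<Longrightarrow> \<one>\<^bsub>H\<^esub> x = x"
  by (simp add: BijGroup_def)

lemma K_space: "h \<in> K \<Longrightarrow> x \<in> space \<mu> \<Longrightarrow> h x \<in> space \<mu>"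
  using Bij_inv_into(4)[OF K_Bij] .

lemma inv_apply:
  assumes "h \<in> K" "x \<in> space \<mu>"
  shows "h ((inv\<^bsub>H\<^esub> h) x) = x" "(inv\<^bsub>H\<^esub> h) (h x) = x"
proof -
  have h: "h \<in> carrier H" and i: "inv\<^bsub>H\<^esub> h \<in> K" using H.inv_closed[of h] assms(1) by simp_all
  show "h ((inv\<^bsub>H\<^esub> h) x) = x"
    using mult_apply[OF assms(1) i assms(2)] one_apply[OF assms(2)] unfolding H.r_inv[OF h] by simp
  show "(inv\<^bsub>H\<^esub> h) (h x) = x"
    using mult_apply[OF i assms(1,2)] one_apply[OF assms(2)] unfolding H.l_inv[OF h] by simp
qed

text \<open>By \<open>K_null_sets\<close>, the preimage under \<open>h\<close> of an exceptional
  null set is again null.\<close>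

lemma AE_apply:
  assumes h: "h \<in> K" and P: "AE x in \<mu>. P x"
  shows "AE x in \<mu>. P (h x)"
proof -
  obtain A where A: "A \<in> null_sets \<mu>" "{x \<in> space \<mu>. \<not> P x} \<subseteq> A"
    using P by (auto simp: eventually_ae_filter)
  have "h -` A \<inter> space \<mu> \<in> null_sets \<mu>"
    using A(1) null_sets_distr_iff[OF K_measurable[OF h], of A] K_null_sets[OF h] by simp
  moreover have "{x \<in> space \<mu>. \<not> P (h x)} \<subseteq> h -` A \<inter> space \<mu>"
    using A(2) K_space[OF h] by auto
  ultimately show ?thesis by (rule AE_I')
qed

lemma ae_trivial_iff: "h \<in> N \<longleftrightarrow> h \<in> K \<and> (AE x in \<mu>. h x = x)"
  by (simp add: ae_trivial_def)

lemma normal_ae_trivial: "N \<lhd> H"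
proof (rule H.normal_invI)
  show "subgroup N H"
  proof (rule H.subgroupI)
    have "AE x in \<mu>. \<one>\<^bsub>H\<^esub> x = x" by (rule AE_I2) (rule one_apply)
    then show "N \<noteq> {}" using H.one_closed ae_trivial_iff by auto
    fix a assume a: "a \<in> N"
    then have aK: "a \<in> K" and a_fix: "AE x in \<mu>. a x = x" by (simp_all add: ae_trivial_iff)
    have "AE x in \<mu>. (inv\<^bsub>H\<^esub> a) x = x"
      using a_fix AE_space
    proof eventually_elim
      case (elim x)
      then show ?case using inv_apply(2)[OF aK elim(2)] by simp
    qed
    then show "inv\<^bsub>H\<^esub> a \<in> N" using H.inv_closed[of a] aK by (simp add: ae_trivial_iff)
    fix b assume "b \<in> N"
    then have bK: "b \<in> K" and b_fix: "AE x in \<mu>. b x = x" by (simp_all add: ae_trivial_iff)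
    have "AE x in \<mu>. (a \<otimes>\<^bsub>H\<^esub> b) x = x"
      using a_fix b_fix AE_space
    proof eventually_elim
      case (elim x)
      then show ?case using mult_apply[OF aK bK elim(3)] by simp
    qed
    then show "a \<otimes>\<^bsub>H\<^esub> b \<in> N" using H.m_closed[of a b] aK bK by (simp add: ae_trivial_iff)
  qed (auto simp: ae_trivial_iff)
next
  fix x h assume x: "x \<in> carrier H" and h: "h \<in> N"
  have xK: "x \<in> K" using x by simp
  have hK: "h \<in> K" and h_fix: "AE y in \<mu>. h y = y" using h by (simp_all add: ae_trivial_iff)
  have iK: "inv\<^bsub>H\<^esub> x \<in> K" using H.inv_closed[OF x] by simp
  have xhK: "x \<otimes>\<^bsub>H\<^esub> h \<in> K" using H.m_closed[OF x, of h] hK by simp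
  \<comment> \<open>The conjugate fixes \<open>y\<close> as soon as \<open>h\<close> fixes the image
    of \<open>y\<close> under the inverse of \<open>x\<close>; that inverse lies in
    \<open>K\<close>, so this happens almost everywhere.\<close>
  have "AE y in \<mu>. (x \<otimes>\<^bsub>H\<^esub> h \<otimes>\<^bsub>H\<^esub> inv\<^bsub>H\<^esub> x) y = y"
    using AE_apply[OF iK h_fix] AE_space
  proof eventually_elim
    case (elim y)
    then show ?case
      using mult_apply[OF xhK iK elim(2)] mult_apply[OF xK hK K_space[OF iK elim(2)]]
        inv_apply(1)[OF xK elim(2)] by simp
  qed
  then show "x \<otimes>\<^bsub>H\<^esub> h \<otimes>\<^bsub>H\<^esub> inv\<^bsub>H\<^esub> x \<in> N"
    using H.m_closed[of "x \<otimes>\<^bsub>H\<^esub> h" "inv\<^bsub>H\<^esub> x"] xhK iK by (simp add: ae_trivial_iff)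
qed

text \<open>Equality of right cosets gives \<open>a\<close> as an almost trivial \<open>n\<close>
  applied after \<open>b\<close>, so the null set where \<open>n\<close> moves points has to be
  pulled back through \<open>b\<close>.\<close>

lemma coset_eq_imp_AE_eq:
  assumes a: "a \<in> K" and b: "b \<in> K" and eq: "N #>\<^bsub>H\<^esub> a = N #>\<^bsub>H\<^esub> b"
  shows "AE x in \<mu>. a x = b x"
proof -
  have "a \<in> N #>\<^bsub>H\<^esub> b"
    using H.rcos_self[of a N] normal_imp_subgroup[OF normal_ae_trivial] a eq by simp
  then obtain n where n: "n \<in> N" "a = n \<otimes>\<^bsub>H\<^esub> b" by (auto simp: r_coset_def)
  then have nK: "n \<in> K" and n_fix: "AE x in \<mu>. n x = x" by (simp_all add: ae_trivial_iff)
  show ?thesis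
    using AE_apply[OF b n_fix] AE_space
  proof eventually_elim
    case (elim x)
    then show ?case using mult_apply[OF nK b elim(2)] n(2) by simp
  qed
qed

text \<open>Commutation of classes gives, for each \<open>g\<close>, an identity off a null set
  depending on \<open>g\<close>. Countability of \<open>S\<close> merges these into a single null
  set, and off it \<open>separate\<close> applies to \<open>x\<close> and
  \<open>h x\<close>.\<close>

lemma centralizer_ae_quotient:
  assumes S: "S \<subseteq> K" "countable S"
    and separate: "\<And>x y. x \<in> space \<mu> \<Longrightarrow> y \<in> space \<mu> \<Longrightarrow>
      (\<And>g. g \<in> S \<Longrightarrow> g x = x \<Longrightarrow> g y = y) \<Longrightarrow> x = y"
  shows "centralizer (ae_quotient \<mu> H) (ae_class \<mu> H ` S) = {\<one>\<^bsub>ae_quotient \<mu> H\<^esub>}"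
proof (intro subset_antisym subsetI)
  interpret N: normal N H by (rule normal_ae_trivial)
  interpret Q: group "H Mod N" by (rule N.factorgroup_is_group)
  have coset: "ae_class \<mu> H g = N #>\<^bsub>H\<^esub> g" for g by (simp add: ae_class_def)
  have coset_Q: "ae_class \<mu> H g \<in> carrier (H Mod N)" if "g \<in> K" for g
    using that by (auto simp: coset carrier_FactGroup)
  show "c \<in> centralizer (ae_quotient \<mu> H) (ae_class \<mu> H ` S)"
    if "c \<in> {\<one>\<^bsub>ae_quotient \<mu> H\<^esub>}" for c
  proof -
    have "\<one>\<^bsub>H Mod N\<^esub> \<otimes>\<^bsub>H Mod N\<^esub> ae_class \<mu> H g = ae_class \<mu> H g \<otimes>\<^bsub>H Mod N\<^esub> \<one>\<^bsub>H Mod N\<^esub>"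
      if "g \<in> S" for g
      using that S(1) by (simp only: Q.l_one[OF coset_Q] Q.r_one[OF coset_Q] subsetD)
    then show ?thesis
      using that Q.one_closed
      by (simp add: centralizer_def ae_quotient_def del: one_FactGroup mult_FactGroup)
  qed
  fix c assume "c \<in> centralizer (ae_quotient \<mu> H) (ae_class \<mu> H ` S)"
  then have c: "c \<in> carrier (H Mod N)"
    and comm: "\<And>g. g \<in> S \<Longrightarrow> c <#>\<^bsub>H\<^esub> (N #>\<^bsub>H\<^esub> g) = (N #>\<^bsub>H\<^esub> g) <#>\<^bsub>H\<^esub> c"
    by (simp_all add: centralizer_def ae_quotient_def coset)
  obtain h where h: "h \<in> K" "c = N #>\<^bsub>H\<^esub> h"
    using c by (auto simp: carrier_FactGroup)
  have "AE x in \<mu>. h (g x) = g (h x)" if g: "g \<in> S" for g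
  proof -
    have gK: "g \<in> K" using g S(1) by blast
    have hg: "h \<otimes>\<^bsub>H\<^esub> g \<in> K" "g \<otimes>\<^bsub>H\<^esub> h \<in> K"
      using H.m_closed[of h g] H.m_closed[of g h] h(1) gK by simp_all
    \<comment> \<open>Cosets of a normal subgroup multiply through representatives, so commuting
      classes have representatives that commute modulo \<open>N\<close>.\<close>
    have "N #>\<^bsub>H\<^esub> (h \<otimes>\<^bsub>H\<^esub> g) = N #>\<^bsub>H\<^esub> (g \<otimes>\<^bsub>H\<^esub> h)"
      using comm[OF g] N.rcos_sum[of h g] N.rcos_sum[of g h] h gK by simp
    from coset_eq_imp_AE_eq[OF hg this] AE_space show ?thesis
    proof eventually_elim
      case (elim x)
      then show ?case using mult_apply[OF h(1) gK elim(2)] mult_apply[OF gK h(1) elim(2)] by simp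
    qed
  qed
  then have "AE x in \<mu>. \<forall>g\<in>S. h (g x) = g (h x)"
    using S(2) by (simp add: AE_ball_countable)
  then have "AE x in \<mu>. h x = x"
    using AE_space
  proof eventually_elim
    case (elim x)
    have "g (h x) = h x" if "g \<in> S" "g x = x" for g using elim(1) that by metis
    then show ?case using separate[OF elim(2) K_space[OF h(1) elim(2)]] by simp
  qed
  then have "h \<in> N" using h(1) by (simp add: ae_trivial_iff)
  then have "c = N" using h H.coset_join2[of h N] N.subgroup_axioms by simp
  then show "c \<in> {\<one>\<^bsub>ae_quotient \<mu> H\<^esub>}" by (simp add: ae_quotient_def)
qed

end

text \<open>These three sets restate the carriers of the groups of Borel automorphisms over an
  arbitrary measure space, so that their group properties do not involve the tree; for the boundary
  measure they are matched with those groups further on.\<close>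

definition borel_auts :: "'x measure \<Rightarrow> ('x \<Rightarrow> 'x) set" where
  "borel_auts M = {h \<in> Bij (space M). h \<in> M \<rightarrow>\<^sub>M M \<and> inv_into (space M) h \<in> M \<rightarrow>\<^sub>M M}"

definition mp_auts :: "'x measure \<Rightarrow> ('x \<Rightarrow> 'x) set" where
  "mp_auts M = {h \<in> borel_auts M. distr M M h = M}"

definition mcp_auts :: "'x measure \<Rightarrow> ('x \<Rightarrow> 'x) set" where
  "mcp_auts M = {h \<in> borel_auts M. null_sets (distr M M h) = null_sets M}"

lemma borel_autsD:
  assumes "h \<in> borel_auts M"
  shows "h \<in> Bij (space M)" "h \<in> M \<rightarrow>\<^sub>M M" "restrict (inv_into (space M) h) (space M) \<in> M \<rightarrow>\<^sub>M M"
  using assms by (auto simp: borel_auts_def cong: measurable_cong)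

lemma borel_auts_id: "(\<lambda>x\<in>space M. x) \<in> borel_auts M"
proof -
  have "(\<lambda>x\<in>space M. x) \<in> M \<rightarrow>\<^sub>M M" by (simp cong: measurable_cong)
  moreover have "inv_into (space M) (\<lambda>x\<in>space M. x) x = x" if "x \<in> space M" for x
    using Bij_inv_into(2)[OF id_Bij that] Bij_inv_into(1)[OF id_Bij that] by simp
  ultimately show ?thesis by (simp add: borel_auts_def id_Bij cong: measurable_cong)
qed

lemma borel_auts_compose:
  assumes f: "f \<in> borel_auts M" and g: "g \<in> borel_auts M"
  shows "compose (space M) f g \<in> borel_auts M"
proof -
  note fg = borel_autsD[OF f] borel_autsD[OF g]
  have "(\<lambda>x. f (g x)) \<in> M \<rightarrow>\<^sub>M M" using fg by measurable
  then have "compose (space M) f g \<in> M \<rightarrow>\<^sub>M M"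
    by (simp add: compose_def cong: measurable_cong)
  moreover have "(\<lambda>x. inv_into (space M) g (inv_into (space M) f x)) \<in> M \<rightarrow>\<^sub>M M"
    using f g measurable_compose by (fastforce simp: borel_auts_def)
  then have "inv_into (space M) (compose (space M) f g) \<in> M \<rightarrow>\<^sub>M M"
    using inv_into_compose_Bij[OF fg(1) fg(4)] by (simp cong: measurable_cong)
  ultimately show ?thesis using compose_Bij[OF fg(1) fg(4)] by (simp add: borel_auts_def)
qed

lemma borel_auts_inv:
  assumes f: "f \<in> borel_auts M"
  shows "restrict (inv_into (space M) f) (space M) \<in> borel_auts M"
proof -
  note fD = borel_autsD[OF f]
  have "inv_into (space M) (restrict (inv_into (space M) f) (space M)) \<in> M \<rightarrow>\<^sub>M M"
    using fD(2) inv_into_restrict_inv_into[OF fD(1)] by (simp cong: measurable_cong)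
  then show ?thesis using fD(3) restrict_inv_into_Bij[OF fD(1)] by (simp add: borel_auts_def)
qed

lemma distr_compose:
  assumes "f \<in> M \<rightarrow>\<^sub>M M" "g \<in> M \<rightarrow>\<^sub>M M"
  shows "distr M M (compose (space M) f g) = distr (distr M M g) M f"
proof -
  have "distr M M (compose (space M) f g) = distr M M (f \<circ> g)"
    by (rule distr_cong) (simp_all add: compose_eq)
  then show ?thesis using distr_distr[of f M M g M] assms by simp
qed

lemma distr_restrict_id: "distr M M (\<lambda>x\<in>space M. x) = M"
  using distr_cong[of M M M M "\<lambda>x\<in>space M. x" "\<lambda>x. x"] by (simp add: distr_id2)

lemma subgroup_mp_auts: "subgroup (mp_auts M) (BijGroup (space M))"
proof (rule subgroup_BijGroupI)
  show "mp_auts M \<subseteq> Bij (space M)" by (auto simp: mp_auts_def dest: borel_autsD(1))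
  show "(\<lambda>x\<in>space M. x) \<in> mp_auts M"
    by (simp add: mp_auts_def borel_auts_id distr_restrict_id)
  fix f assume "f \<in> mp_auts M"
  then have f: "f \<in> borel_auts M" "distr M M f = M" by (simp_all add: mp_auts_def)
  note fD = borel_autsD[OF f(1)]
  show "restrict (inv_into (space M) f) (space M) \<in> mp_auts M"
    \<comment> \<open>As \<open>f\<close> preserves \<open>M\<close>, pushing \<open>M\<close>
      forward by the inverse of \<open>f\<close> equals pushing it forward by \<open>f\<close> and
      then by the inverse, and the composite is the identity.\<close>
    using distr_compose[OF fD(3,2)] Bij_compose_restrict_eq[OF fD(1)] f distr_restrict_id[of M]
    by (simp add: mp_auts_def borel_auts_inv)
  fix g assume "g \<in> mp_auts M"
  then have g: "g \<in> borel_auts M" "distr M M g = M" by (simp_all add: mp_auts_def)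
  show "compose (space M) f g \<in> mp_auts M"
    using distr_compose[OF fD(2) borel_autsD(2)[OF g(1)]] f g
    by (simp add: mp_auts_def borel_auts_compose)
qed

text \<open>A measurable set is null for a pushforward exactly when its preimage is null, so only
  the measure class of the source matters.\<close>

lemma null_sets_distr_cong:
  assumes "null_sets M = null_sets M'" "sets M = sets M'" "f \<in> M \<rightarrow>\<^sub>M N"
  shows "null_sets (distr M N f) = null_sets (distr M' N f)"
proof -
  have "f \<in> M' \<rightarrow>\<^sub>M N" using assms by (simp cong: measurable_cong_sets)
  then show ?thesis
    using assms sets_eq_imp_space_eq[OF assms(2)] by (auto simp: null_sets_distr_iff)
qed

lemma subgroup_mcp_auts: "subgroup (mcp_auts M) (BijGroup (space M))"
proof (rule subgroup_BijGroupI)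
  show "mcp_auts M \<subseteq> Bij (space M)" by (auto simp: mcp_auts_def dest: borel_autsD(1))
  show "(\<lambda>x\<in>space M. x) \<in> mcp_auts M"
    by (simp add: mcp_auts_def borel_auts_id distr_restrict_id)
  \<comment> \<open>This replaces \<open>distr_compose\<close> up to measure class: pushing forward
    by \<open>g\<close> first does not change which sets are null. The inverse is then treated as
    for \<open>mp_auts\<close>.\<close>
  have null_compose: "null_sets (distr M M (compose (space M) f g)) = null_sets (distr M M f)"
    if "f \<in> M \<rightarrow>\<^sub>M M" "g \<in> M \<rightarrow>\<^sub>M M" "null_sets (distr M M g) = null_sets M" for f g
    using null_sets_distr_cong[of "distr M M g" M f M] that by (simp add: distr_compose)
  fix f assume "f \<in> mcp_auts M"
  then have f: "f \<in> borel_auts M" "null_sets (distr M M f) = null_sets M"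
    by (simp_all add: mcp_auts_def)
  note fD = borel_autsD[OF f(1)]
  show "restrict (inv_into (space M) f) (space M) \<in> mcp_auts M"
    using null_compose[OF fD(3,2) f(2)] Bij_compose_restrict_eq[OF fD(1)] f distr_restrict_id[of M]
    by (simp add: mcp_auts_def borel_auts_inv)
  fix g assume "g \<in> mcp_auts M"
  then have g: "g \<in> borel_auts M" "null_sets (distr M M g) = null_sets M"
    by (simp_all add: mcp_auts_def)
  show "compose (space M) f g \<in> mcp_auts M"
    using null_compose[OF fD(2) borel_autsD(2)[OF g(1)]] f g
    by (simp add: mcp_auts_def borel_auts_compose)
qed

lemma mp_auts_subset_mcp_auts: "mp_auts M \<subseteq> mcp_auts M"
  by (auto simp: mp_auts_def mcp_auts_def)

lemma measure_class_group_mcp_auts: "measure_class_group M (mcp_auts M)"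
  by (rule measure_class_group.intro[OF subgroup_mcp_auts])
    (simp_all add: mcp_auts_def borel_autsD(2))

lemma measure_class_group_mp_auts: "measure_class_group M (mp_auts M)"
  by (rule measure_class_group.intro[OF subgroup_mp_auts])
    (simp_all add: mp_auts_def borel_autsD(2))

section \<open>The boundary\<close>

context tree
begin

abbreviation "\<Delta> \<equiv> boundary T"
abbreviation "\<B> \<equiv> boundary_borel T"

lemma boundary_level: "p \<in> \<Delta> \<Longrightarrow> p n \<in> L n"
  by (simp add: boundary_def)

text \<open>Levels are disjoint, so the index at which a path meets \<open>v\<close> can only be the
  level of \<open>v\<close>.\<close>

lemma cylinder_level: "v \<in> L n \<Longrightarrow> cylinder T v = {p \<in> \<Delta>. p n = v}"
  unfolding cylinder_def using boundary_level level_unique by (metis (lifting))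

lemma cylinder_subset: "cylinder T v \<subseteq> \<Delta>"
  by (auto simp: cylinder_def)

text \<open>All paths start at the root. This makes the whole boundary a basic open set, and later a
  member of the generating family on which measures are compared.\<close>

lemma boundary_eq_cylinder: "\<exists>r\<in>L 0. \<Delta> = cylinder T r"
proof -
  obtain r where r: "L 0 = {r}" using root_level by blast
  then show ?thesis using cylinder_level[of r 0] boundary_level[of _ 0] by auto
qed

text \<open>Parents are unique, so agreement at level \<open>n\<close> propagates back to the
  root.\<close>

lemma boundary_prefix:
  assumes "p \<in> \<Delta>" "q \<in> \<Delta>" "p n = q n" "m \<le> n"
  shows "p m = q m"
  using assms(4,3)
proof (induction rule: inc_induct)
  case (step k)
  have "adj T (p k) (p (Suc k))" "adj T (q k) (q (Suc k))"
    using assms(1,2) by (simp_all add: boundary_def)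
  then show ?case
    using boundary_level[OF assms(1)] boundary_level[OF assms(2)] parent_unique[of "p (Suc k)" k]
      step by simp
qed

lemma cylinder_mono:
  assumes "p \<in> \<Delta>" "m \<le> n"
  shows "cylinder T (p n) \<subseteq> cylinder T (p m)"
  using boundary_prefix[OF _ assms(1) _ assms(2)]
  by (auto simp: cylinder_level[OF boundary_level[OF assms(1)]])

lemma topspace_boundary: "topspace (boundary_topology T) = \<Delta>"
  using boundary_eq_cylinder cylinder_subset level_verts
  by (fastforce simp: boundary_topology_def)

lemma openin_boundary_subset: "{U. openin (boundary_topology T) U} \<subseteq> Pow \<Delta>"
  using openin_subset topspace_boundary by blast

lemma space_boundary_borel: "space \<B> = \<Delta>"
  using openin_boundary_subset by (simp add: boundary_borel_def space_measure_of)

text \<open>The cylinders along a path are nested, so the generating family behaves like a basis: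
  for an intersection, the deeper of two cylinders is contained in both sets.\<close>

lemma openin_contains_cylinder:
  assumes "openin (boundary_topology T) U" "p \<in> U"
  shows "\<exists>n. cylinder T (p n) \<subseteq> U"
proof -
  have "generate_topology_on (cylinder T ` V) U"
    using assms(1) by (simp add: boundary_topology_def openin_topology_generated_by_iff)
  moreover have "p \<in> \<Delta>" using assms openin_subset topspace_boundary by blast
  ultimately show ?thesis using assms(2)
  proof induction
    case (Int a b)
    then obtain m n where "cylinder T (p m) \<subseteq> a" "cylinder T (p n) \<subseteq> b" by blast
    then have "cylinder T (p (max m n)) \<subseteq> a \<inter> b"
      using cylinder_mono[OF Int.prems(1), of m "max m n"]
        cylinder_mono[OF Int.prems(1), of n "max m n"] by auto
    then show ?case by blast
  next
    case (UN \<U>)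
    then obtain U where "U \<in> \<U>" "p \<in> U" by blast
    then show ?case using UN.IH[of U] UN.prems(1) by blast
  next
    case (Basis U)
    then obtain v where "U = cylinder T v" by blast
    moreover have "\<exists>n. p n = v" using Basis calculation by (simp add: cylinder_def)
    ultimately show ?case by blast
  qed simp
qed

section \<open>The action of tree automorphisms on the boundary\<close>

lemma boundary_map_boundary:
  assumes g: "g \<in> Aut" and p: "p \<in> \<Delta>"
  shows "boundary_map T g p \<in> \<Delta>"
proof -
  have "g (p n) \<in> L n \<and> adj T (g (p n)) (g (p (Suc n)))" for n
    using Aut_level[OF g boundary_level[OF p]] p
      Aut_adj[OF g level_verts[OF boundary_level[OF p]] level_verts[OF boundary_level[OF p]]]
    by (simp add: boundary_def)
  then show ?thesis using p by (simp add: boundary_map_def boundary_def)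
qed

lemma boundary_map_inverse:
  assumes g: "g \<in> Aut" and p: "p \<in> \<Delta>"
  shows "boundary_map T (m_inv (tree_aut_group T) g) (boundary_map T g p) = p"
    and "boundary_map T g (boundary_map T (m_inv (tree_aut_group T) g) p) = p"
proof -
  let ?i = "m_inv (tree_aut_group T) g"
  have i: "?i \<in> Aut" using group.inv_closed[OF group_Aut g] .
  note inv = Aut_inv[OF g level_verts[OF boundary_level[OF p]]]
  show "boundary_map T ?i (boundary_map T g p) = p"
    using boundary_map_boundary[OF g p] p inv by (simp add: boundary_map_def)
  show "boundary_map T g (boundary_map T ?i p) = p"
    using boundary_map_boundary[OF i p] p inv by (simp add: boundary_map_def)
qed

lemma boundary_map_Bij:
  assumes g: "g \<in> Aut"
  shows "boundary_map T g \<in> Bij \<Delta>"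
proof -
  have "bij_betw (boundary_map T g) \<Delta> \<Delta>"
    using boundary_map_inverse[OF g] boundary_map_boundary[OF g]
      boundary_map_boundary[OF group.inv_closed[OF group_Aut g]]
    by (intro bij_betwI[where g = "boundary_map T (m_inv (tree_aut_group T) g)"]) auto
  then show ?thesis by (simp add: Bij_def boundary_map_def)
qed

lemma inv_into_boundary_map:
  assumes g: "g \<in> Aut" and p: "p \<in> \<Delta>"
  shows "inv_into \<Delta> (boundary_map T g) p = boundary_map T (m_inv (tree_aut_group T) g) p"
  using Bij_inv_into(3)[OF boundary_map_Bij[OF g]
      boundary_map_boundary[OF group.inv_closed[OF group_Aut g] p]]
    boundary_map_inverse(2)[OF g p] by simp

text \<open>The inverse of \<open>g\<close> preserves levels, so the cylinder on the right belongs
  to a vertex of level \<open>n\<close> too. Measurability and invariance of the measure both come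
  from this.\<close>

lemma boundary_map_vimage_cylinder:
  assumes g: "g \<in> Aut" and v: "v \<in> L n"
  shows "boundary_map T g -` cylinder T v \<inter> \<Delta> = cylinder T (m_inv (tree_aut_group T) g v)"
proof -
  let ?i = "m_inv (tree_aut_group T) g"
  have iv: "?i v \<in> L n" using Aut_level[OF group.inv_closed[OF group_Aut g] v] .
  have "g (p n) = v \<longleftrightarrow> p n = ?i v" if "p \<in> \<Delta>" for p
    using Aut_inv[OF g level_verts[OF v]] Aut_inv(2)[OF g level_verts[OF boundary_level[OF that]]]
    by auto
  moreover have "boundary_map T g p \<in> cylinder T v \<longleftrightarrow> g (p n) = v" if "p \<in> \<Delta>" for p
    using boundary_map_boundary[OF g that] that v
    by (simp add: cylinder_level boundary_map_def)
  ultimately show ?thesis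
    using iv by (auto simp: cylinder_level)
qed

end

section \<open>Borel sets of the boundary of a spherically homogeneous tree\<close>

locale homogeneous_tree = tree T for T :: "'v levelled_graph" +
  fixes d :: "nat \<Rightarrow> nat"
  assumes homogeneous: "spherically_homogeneous T d"
begin

lemma finite_level: "finite (L n)"
proof (induction n)
  case 0
  then show ?case using root_level by auto
next
  case (Suc n)
  have "L (Suc n) \<subseteq> (\<Union>v\<in>L n. {w \<in> L (Suc n). adj T v w})"
    using parent_exists[of _ n] by blast
  moreover have "finite (\<Union>v\<in>L n. {w \<in> L (Suc n). adj T v w})"
    using Suc homogeneous by (auto simp: spherically_homogeneous_def)
  ultimately show ?case by (rule finite_subset)
qed

lemma countable_verts: "countable V"
  using countable_finite[OF finite_level] by (simp add: verts_def)

text \<open>Levels are finite, so there are countably many vertices and every open set is the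
  countable union of the cylinders it contains.\<close>

lemma sets_boundary_borel: "sets \<B> = sigma_sets \<Delta> (cylinder T ` V)"
proof -
  have cyl: "cylinder T ` V \<subseteq> Pow \<Delta>" using cylinder_subset by auto
  interpret sigma_algebra "\<Delta>" "sigma_sets \<Delta> (cylinder T ` V)"
    using sigma_algebra_sigma_sets[OF cyl] .
  have "sigma_sets \<Delta> {U. openin (boundary_topology T) U} = sigma_sets \<Delta> (cylinder T ` V)"
  proof (rule sigma_sets_eqI)
    fix U assume "U \<in> {U. openin (boundary_topology T) U}"
    then have U: "openin (boundary_topology T) U" by simp
    let ?W = "{v \<in> V. cylinder T v \<subseteq> U}"
    have "p \<in> (\<Union>v\<in>?W. cylinder T v)" if p: "p \<in> U" for p
    proof -
      have "p \<in> \<Delta>" using p openin_subset[OF U] topspace_boundary by auto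
      moreover obtain n where "cylinder T (p n) \<subseteq> U"
        using openin_contains_cylinder[OF U p] by blast
      moreover have "p n \<in> V" using level_verts[OF boundary_level] calculation(1) .
      ultimately show ?thesis by (auto simp: cylinder_def)
    qed
    then have "U = (\<Union>v\<in>?W. cylinder T v)" by auto
    moreover have "countable ?W" using countable_verts by simp
    then have "(\<Union>v\<in>?W. cylinder T v) \<in> sigma_sets \<Delta> (cylinder T ` V)"
      by (rule countable_UN') auto
    ultimately show "U \<in> sigma_sets \<Delta> (cylinder T ` V)" by simp
  next
    fix C assume "C \<in> cylinder T ` V"
    then show "C \<in> sigma_sets \<Delta> {U. openin (boundary_topology T) U}"
      by (intro sigma_sets.Basic) (simp add: boundary_topology_def topology_generated_by_Basis)
  qed
  then show ?thesis using openin_boundary_subset by (simp add: boundary_borel_def)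
qed

lemma boundary_map_measurable:
  assumes g: "g \<in> Aut"
  shows "boundary_map T g \<in> \<B> \<rightarrow>\<^sub>M \<B>"
proof (rule measurable_sigma_sets[OF sets_boundary_borel])
  show "cylinder T ` V \<subseteq> Pow \<Delta>" using cylinder_subset by auto
  show "boundary_map T g \<in> space \<B> \<rightarrow> \<Delta>"
    using boundary_map_boundary[OF g] by (simp add: space_boundary_borel)
  fix C assume "C \<in> cylinder T ` V"
  then obtain v n where v: "v \<in> L n" "C = cylinder T v" by (auto simp: verts_def)
  have "m_inv (tree_aut_group T) g v \<in> V" using Aut_inv(3)[OF g level_verts[OF v(1)]] .
  then show "boundary_map T g -` C \<inter> space \<B> \<in> sets \<B>"
    using boundary_map_vimage_cylinder[OF g v(1)] v(2)
    by (simp add: space_boundary_borel sets_boundary_borel)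
qed

end

section \<open>The uniform measure and its invariance\<close>

locale measured_tree = homogeneous_tree T d
  for T :: "'v levelled_graph" and d :: "nat \<Rightarrow> nat" +
  fixes \<mu> :: "(nat \<Rightarrow> 'v) measure"
  assumes uniform: "uniform_boundary_measure T d \<mu>"
begin

sublocale \<mu>: prob_space \<mu>
  using uniform by (simp add: uniform_boundary_measure_def)

lemma sets_\<mu>: "sets \<mu> = sets \<B>"
  using uniform by (simp add: uniform_boundary_measure_def)

lemma space_\<mu>: "space \<mu> = \<Delta>"
  using sets_eq_imp_space_eq[OF sets_\<mu>] space_boundary_borel by simp

lemma measurable_\<mu>: "\<mu> \<rightarrow>\<^sub>M \<mu> = \<B> \<rightarrow>\<^sub>M \<B>"
  using measurable_cong_sets[OF sets_\<mu> sets_\<mu>] .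

lemma emeasure_cylinder:
  "v \<in> L n \<Longrightarrow> emeasure \<mu> (cylinder T v) = ennreal (1 / real (\<Prod>i<n. d i))"
  using uniform by (simp add: uniform_boundary_measure_def \<mu>.emeasure_eq_measure)

text \<open>Two cylinders with a common path are nested. With the empty set added, cylinders thus
  form a family stable under intersection, as uniqueness of measures requires.\<close>

lemma cylinder_Int:
  assumes "u \<in> V" "v \<in> V"
  shows "cylinder T u \<inter> cylinder T v \<in> insert {} (cylinder T ` V)"
proof (cases "cylinder T u \<inter> cylinder T v = {}")
  case False
  then obtain p m n where p: "p \<in> \<Delta>" "p m = u" "p n = v" by (auto simp: cylinder_def)
  then have "cylinder T u \<inter> cylinder T v \<in> {cylinder T u, cylinder T v}"
    using cylinder_mono[OF p(1), of m n] cylinder_mono[OF p(1), of n m]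
    by (cases "m \<le> n") auto
  then show ?thesis using assms by auto
qed simp

text \<open>The measure of a cylinder depends only on the level, which preimages preserve; two
  finite measures that agree on the cylinders are equal.\<close>

lemma distr_boundary_map:
  assumes g: "g \<in> Aut"
  shows "distr \<mu> \<mu> (boundary_map T g) = \<mu>"
proof -
  let ?E = "insert {} (cylinder T ` V)"
  have meas: "boundary_map T g \<in> \<mu> \<rightarrow>\<^sub>M \<mu>"
    using boundary_map_measurable[OF g] by (simp add: measurable_\<mu>)
  obtain r where r: "r \<in> L 0" "\<Delta> = cylinder T r" using boundary_eq_cylinder by blast
  have E: "sigma_sets \<Delta> ?E = sets \<mu>"
    unfolding sets_\<mu> sets_boundary_borel
    by (rule sigma_sets_eqI) (auto intro: sigma_sets.intros)
  show ?thesis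
  \<comment> \<open>The exhausting sequence is constant, because the boundary is the cylinder of the
    root.\<close>
  proof (rule measure_eqI_generator_eq[where E = ?E and \<Omega> = "\<Delta>" and A = "\<lambda>_. \<Delta>"])
    show "Int_stable ?E" using cylinder_Int by (auto simp: Int_stable_def)
    show "?E \<subseteq> Pow \<Delta>" using cylinder_subset by auto
    show "range (\<lambda>_::nat. \<Delta>) \<subseteq> ?E" using r level_verts by auto
    show "emeasure (distr \<mu> \<mu> (boundary_map T g)) \<Delta> \<noteq> \<infinity>"
      using meas space_\<mu> sets.top[of \<mu>] by (simp add: emeasure_distr)
    fix C assume C: "C \<in> ?E"
    show "emeasure (distr \<mu> \<mu> (boundary_map T g)) C = emeasure \<mu> C"
    proof (cases "C = {}")
      case False
      with C obtain v n where v: "v \<in> L n" "C = cylinder T v" by (auto simp: verts_def)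
      have "C \<in> sets \<mu>" using C E by auto
      then have "emeasure (distr \<mu> \<mu> (boundary_map T g)) C =
          emeasure \<mu> (cylinder T (m_inv (tree_aut_group T) g v))"
        using meas boundary_map_vimage_cylinder[OF g v(1)] v(2)
        by (simp add: emeasure_distr space_\<mu>)
      also have "\<dots> = emeasure \<mu> C"
        using emeasure_cylinder v Aut_level[OF group.inv_closed[OF group_Aut g] v(1)] by simp
      finally show ?thesis .
    qed simp
  qed (simp_all add: E)
qed

lemma boundary_map_borel_auts:
  assumes g: "g \<in> Aut"
  shows "boundary_map T g \<in> borel_auts \<mu>"
proof -
  have "inv_into (space \<mu>) (boundary_map T g) \<in> \<mu> \<rightarrow>\<^sub>M \<mu> \<longleftrightarrow>
      boundary_map T (m_inv (tree_aut_group T) g) \<in> \<mu> \<rightarrow>\<^sub>M \<mu>"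
    by (rule measurable_cong) (simp add: space_\<mu> inv_into_boundary_map[OF g])
  then show ?thesis
    using boundary_map_measurable[OF g] boundary_map_Bij[OF g]
      boundary_map_measurable[OF group.inv_closed[OF group_Aut g]]
    by (simp add: borel_auts_def space_\<mu> measurable_\<mu>)
qed

lemma boundary_map_mp_auts: "g \<in> Aut \<Longrightarrow> boundary_map T g \<in> mp_auts \<mu>"
  using boundary_map_borel_auts distr_boundary_map by (simp add: mp_auts_def)

lemma borel_aut_group_eq: "borel_aut_group T = BijGroup (space \<mu>)\<lparr>carrier := borel_auts \<mu>\<rparr>"
  by (simp add: borel_aut_group_def borel_auts_def space_\<mu> measurable_\<mu>)

lemma mp_borel_aut_group_eq:
  "mp_borel_aut_group T \<mu> = BijGroup (space \<mu>)\<lparr>carrier := mp_auts \<mu>\<rparr>"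
  by (simp add: mp_borel_aut_group_def borel_aut_group_eq mp_auts_def)

lemma mcp_borel_aut_group_eq:
  "mcp_borel_aut_group T \<mu> = BijGroup (space \<mu>)\<lparr>carrier := mcp_auts \<mu>\<rparr>"
  by (simp add: mcp_borel_aut_group_def borel_aut_group_eq mcp_auts_def)

end

section \<open>Centralizers\<close>

text \<open>The pointwise counterpart of \<open>centralizer_ae_quotient\<close>, shared by
  homeomorphisms and Borel automorphisms: every element of \<open>S\<close> that fixes
  \<open>x\<close> also fixes \<open>h x\<close>.\<close>

lemma centralizer_BijGroup:
  assumes K: "K \<subseteq> Bij X" "(\<lambda>x\<in>X. x) \<in> K" and S: "S \<subseteq> Bij X"
    and separate: "\<And>x y. x \<in> X \<Longrightarrow> y \<in> X \<Longrightarrow>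
      (\<And>g. g \<in> S \<Longrightarrow> g x = x \<Longrightarrow> g y = y) \<Longrightarrow> x = y"
  shows "centralizer (BijGroup X\<lparr>carrier := K\<rparr>) S = {\<one>\<^bsub>BijGroup X\<lparr>carrier := K\<rparr>\<^esub>}"
proof -
  interpret B: group "BijGroup X" by (rule group_BijGroup)
  have one: "\<one>\<^bsub>BijGroup X\<^esub> = (\<lambda>x\<in>X. x)" by (simp add: BijGroup_def)
  have "\<one>\<^bsub>BijGroup X\<^esub> \<otimes>\<^bsub>BijGroup X\<^esub> g = g \<otimes>\<^bsub>BijGroup X\<^esub> \<one>\<^bsub>BijGroup X\<^esub>" if "g \<in> S" for g
  proof -
    have "g \<in> carrier (BijGroup X)" using that S by (auto simp: BijGroup_def)
    then show ?thesis by simp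
  qed
  then have "\<one>\<^bsub>BijGroup X\<^esub> \<in> centralizer (BijGroup X\<lparr>carrier := K\<rparr>) S"
    using K(2) by (simp add: centralizer_def one)
  moreover have "h = \<one>\<^bsub>BijGroup X\<^esub>"
    if "h \<in> centralizer (BijGroup X\<lparr>carrier := K\<rparr>) S" for h
    unfolding one
  proof (rule Bij_eqI[OF _ id_Bij])
    have h: "h \<in> K" and comm: "\<And>g. g \<in> S \<Longrightarrow> h \<otimes>\<^bsub>BijGroup X\<^esub> g = g \<otimes>\<^bsub>BijGroup X\<^esub> h"
      using that by (simp_all add: centralizer_def)
    show hB: "h \<in> Bij X" using h K by blast
    fix x assume x: "x \<in> X"
    have hx: "h x \<in> X" using Bij_inv_into(4)[OF hB x] .
    have "g (h x) = h x" if g: "g \<in> S" "g x = x" for g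
    proof -
      have "g \<in> Bij X" using g(1) S by blast
      then have "compose X h g x = compose X g h x"
        using comm[OF g(1)] hB by (simp add: BijGroup_def)
      then show ?thesis using x g(2) by (simp add: compose_eq)
    qed
    then show "h x = (\<lambda>x\<in>X. x) x" using separate[OF x hx] x by simp
  qed
  ultimately have "centralizer (BijGroup X\<lparr>carrier := K\<rparr>) S = {\<one>\<^bsub>BijGroup X\<^esub>}" by blast
  then show ?thesis by simp
qed

theorem corollary2:
  fixes T :: "'v levelled_graph"
    and d :: "nat \<Rightarrow> nat"
    and G :: "('v \<Rightarrow> 'v) set"
    and \<mu> :: "(nat \<Rightarrow> 'v) measure"
  assumes "rooted_tree T"
    and "spherically_homogeneous T d"
    and "weakly_branch T G"
    and "countable G"
    and "uniform_boundary_measure T d \<mu>"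
  shows "centralizer (tree_aut_group T) G = {\<one>\<^bsub>tree_aut_group T\<^esub>}
    \<and> centralizer (homeo_group T) (boundary_map T ` G) = {\<one>\<^bsub>homeo_group T\<^esub>}
    \<and> centralizer (mp_aut_group T \<mu>)
         ((\<lambda>g. ae_class \<mu> (mp_borel_aut_group T \<mu>) (boundary_map T g)) ` G)
         = {\<one>\<^bsub>mp_aut_group T \<mu>\<^esub>}
    \<and> centralizer (mcp_aut_group T \<mu>)
         ((\<lambda>g. ae_class \<mu> (mcp_borel_aut_group T \<mu>) (boundary_map T g)) ` G)
         = {\<one>\<^bsub>mcp_aut_group T \<mu>\<^esub>}
    \<and> centralizer (borel_aut_group T) (boundary_map T ` G) = {\<one>\<^bsub>borel_aut_group T\<^esub>}"
proof -
  interpret measured_tree T d \<mu> by unfold_locales (fact assms)+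
  interpret weakly_branch_tree T G by unfold_locales (fact assms)
  let ?S = "boundary_map T ` G"
  have S_mp: "?S \<subseteq> mp_auts \<mu>" using boundary_map_mp_auts[OF G_Aut] by auto
  have S_mcp: "?S \<subseteq> mcp_auts \<mu>" using S_mp mp_auts_subset_mcp_auts[of \<mu>] by simp
  have S_Bij: "?S \<subseteq> Bij \<Delta>" using boundary_map_Bij[OF G_Aut] by auto
  have S_countable: "countable ?S" using assms(4) by simp
  have separate: "p = q"
    if "p \<in> \<Delta>" "q \<in> \<Delta>" "\<And>g. g \<in> ?S \<Longrightarrow> g p = p \<Longrightarrow> g q = q" for p q
    using stabilizers_separate_boundary[OF that(1,2)] that(3) by simp
  have homeo: "homeo_group T = BijGroup \<Delta>\<lparr>carrier :=
      {h \<in> Bij \<Delta>. homeomorphic_map (boundary_topology T) (boundary_topology T) h}\<rparr>"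
    by (simp add: homeo_group_def)
  \<comment> \<open>The unit of \<open>BijGroup\<close> is the restricted identity, which agrees
    with \<open>id\<close> on the whole boundary.\<close>
  have id_homeo: "homeomorphic_map (boundary_topology T) (boundary_topology T) (\<lambda>p\<in>\<Delta>. p)"
    by (rule homeomorphic_map_eq[where f = id]) (simp_all add: topspace_boundary)
  have "centralizer (homeo_group T) ?S = {\<one>\<^bsub>homeo_group T\<^esub>}"
    unfolding homeo by (rule centralizer_BijGroup[OF _ _ S_Bij separate]) (simp_all add: id_Bij id_homeo)
  moreover have "centralizer (borel_aut_group T) ?S = {\<one>\<^bsub>borel_aut_group T\<^esub>}"
    unfolding borel_aut_group_eq space_\<mu>
    using borel_autsD(1)[of _ \<mu>] borel_auts_id[of \<mu>]
    by (intro centralizer_BijGroup[OF _ _ S_Bij separate]) (auto simp: space_\<mu>)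
  moreover have "centralizer (mp_aut_group T \<mu>)
      (ae_class \<mu> (mp_borel_aut_group T \<mu>) ` ?S) = {\<one>\<^bsub>mp_aut_group T \<mu>\<^esub>}"
    unfolding mp_borel_aut_group_eq
    by (rule measure_class_group.centralizer_ae_quotient[OF measure_class_group_mp_auts S_mp S_countable])
      (simp add: separate space_\<mu>)
  moreover have "centralizer (mcp_aut_group T \<mu>)
      (ae_class \<mu> (mcp_borel_aut_group T \<mu>) ` ?S) = {\<one>\<^bsub>mcp_aut_group T \<mu>\<^esub>}"
    unfolding mcp_borel_aut_group_eq
    by (rule measure_class_group.centralizer_ae_quotient[OF measure_class_group_mcp_auts S_mcp S_countable])
      (simp add: separate space_\<mu>)
  ultimately show ?thesis using centralizer_Aut by (simp add: image_image)
qed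

end
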